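(* Let $V$ be a finite set with $|V|\geq 4$ and let $A=(a_{ij})_{i,j\in V}$, $B=(b_{ij})_{i,j\in V}$ be two skew-symmetric matrices with entries in a field $\mathbb{K}$ of characteristic not equal to $2$. Assume that $A$ is dense and HL-indecomposable. If $\det(A[X])=\det(B[X])$ for every subset $X\subseteq V$ with $|X|\leq 4$, then there exists a diagonal matrix $D$ with diagonal entries $d_i\in\{-1,1\}$ such that $B=DAD$ or $B^{t}=DAD$; in particular $\det(A)=\det(B)$.
   Context: For nonempty $X,Y\subseteq V$, $A[X,Y]$ denotes the submatrix of $A$ with row indices in $X$ and column indices in $Y$, and $A[X]:=A[X,X]$. A matrix is dense if all its off-diagonal entries are nonzero. A matrix $A=(a_{ij})_{i,j\in V}$ is HL-indecomposable if for every subset $X\subseteq V$ with $2\leq |X|\leq |V|-2$, at least one of $A[X,V\setminus X]$, $A[V\setminus X,X]$ has rank at least $2$. $B^t$ is the transpose of $B$. *)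

theory Defs
  imports
    "HOL-Library.Countable_Set"
    "HOL-Computational_Algebra.Computational_Algebra"
    "Jordan_Normal_Form.Determinant"
    "Jordan_Normal_Form.DL_Rank"
begin

text \<open>
  A matrix with rows and columns indexed by a finite set \<open>V\<close> is a function
  \<open>'v \<Rightarrow> 'v \<Rightarrow> 'k\<close>, of which only the values on \<open>V \<times> V\<close> matter.
  \<open>submat A X Y\<close> is \<open>A[X,Y]\<close> as a matrix of the library, which numbers rows and columns from 0.
  For this, \<open>from_nat_into X\<close> enumerates a finite set \<open>X\<close> bijectively by \<open>{..<card X}\<close>
  (lemma \<open>bij_betw_from_nat_into_finite\<close>). The enumeration depends on \<open>X\<close> only, so rows and
  columns of \<open>A[X,X]\<close> are listed in the same order, and all matrices on \<open>V\<close> use the same order.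
\<close>

definition submat :: "('v \<Rightarrow> 'v \<Rightarrow> 'k) \<Rightarrow> 'v set \<Rightarrow> 'v set \<Rightarrow> 'k mat" where
  "submat A X Y = mat (card X) (card Y) (\<lambda>(i, j). A (from_nat_into X i) (from_nat_into Y j))"

definition skew_symmetric_on :: "'v set \<Rightarrow> ('v \<Rightarrow> 'v \<Rightarrow> 'k::ring_1) \<Rightarrow> bool" where
  "skew_symmetric_on V A \<longleftrightarrow> (\<forall>i\<in>V. \<forall>j\<in>V. A j i = - A i j)"

definition dense_on :: "'v set \<Rightarrow> ('v \<Rightarrow> 'v \<Rightarrow> 'k::zero) \<Rightarrow> bool" where
  "dense_on V A \<longleftrightarrow> (\<forall>i\<in>V. \<forall>j\<in>V. i \<noteq> j \<longrightarrow> A i j \<noteq> 0)"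

text \<open>The first argument of \<^const>\<open>vec_space.rank\<close> is the number of rows.\<close>

definition HL_indecomposable :: "'v set \<Rightarrow> ('v \<Rightarrow> 'v \<Rightarrow> 'k::field) \<Rightarrow> bool" where
  "HL_indecomposable V A \<longleftrightarrow>
     (\<forall>X\<subseteq>V. 2 \<le> card X \<and> card X + 2 \<le> card V \<longrightarrow>
        vec_space.rank (card X) (submat A X (V - X)) \<ge> 2 \<or>
        vec_space.rank (card (V - X)) (submat A (V - X) X) \<ge> 2)"

definition diag_matrix :: "('v \<Rightarrow> 'k) \<Rightarrow> 'v \<Rightarrow> 'v \<Rightarrow> 'k::zero" where
  "diag_matrix d i j = (if i = j then d i else 0)"

end

theory Submission
  imports Defs
begin

text \<open>
  Fix \<open>v\<close> and put \<open>W = V - {v}\<close>, \<open>w i j = A i j / (A v i * A v j)\<close>, and define \<open>u\<close> from \<open>B\<close> likewise.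
  The minors of order 2 give \<open>u = \<plusminus>w\<close> entrywise, so the pairs of \<open>W\<close> are coloured by this sign; the
  claim is that the colouring is constant. HL-indecomposability of \<open>A\<close> says that \<open>w\<close> is primitive: a
  set \<open>M\<close> whose elements all have the same \<open>w k i\<close>, for each \<open>k\<close> outside \<open>M\<close>, would make
  \<open>A[M, V - M]\<close> of rank 1.

  Comparing squared Pfaffians on \<open>{v, k, i, j}\<close>: if \<open>ki\<close> and \<open>kj\<close> have one colour and \<open>ij\<close> the
  other, then \<open>w k i = w k j\<close>. This is the forcing relation of Gallai's theory of transitive
  orientations. If both colours occur, primitivity of \<open>w\<close> makes both colour classes connected and the
  colouring itself primitive, Gallai's triangle lemma makes \<open>w\<close> constant up to sign on each colour
  and free of cyclic triangles, and an induced path on four vertices, compared through its own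
  Pfaffian, equates the two constants up to sign. Hence \<open>w\<close> is a multiple of a transitive
  tournament; deleting its source leaves a proper clan, a contradiction.
\<close>

subsection \<open>Primitive colourings\<close>

text \<open>These are the modules (clans) of 2-structures. Testing only the values
  \<open>f k i\<close> with \<open>k\<close> outside \<open>M\<close> suffices, because
  \<open>s\<close> is symmetric and \<open>w\<close> is skew.\<close>

definition clan :: "'v set \<Rightarrow> ('v \<Rightarrow> 'v \<Rightarrow> 'a) \<Rightarrow> 'v set \<Rightarrow> bool" where
  "clan W f M \<longleftrightarrow> M \<subseteq> W \<and> (\<forall>k\<in>W - M. \<forall>i\<in>M. \<forall>j\<in>M. f k i = f k j)"

definition primitive :: "'v set \<Rightarrow> ('v \<Rightarrow> 'v \<Rightarrow> 'a) \<Rightarrow> bool" where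
  "primitive W f \<longleftrightarrow> (\<forall>M. clan W f M \<longrightarrow> card M \<ge> 2 \<longrightarrow> M = W)"

lemma primitive_clan:
  assumes "primitive W f" "finite W" "clan W f M" "x \<in> M" "y \<in> M" "x \<noteq> y"
  shows "M = W"
proof -
  have "M \<subseteq> W"
    using assms(3) by (simp add: clan_def)
  then have "finite M"
    using assms(2) finite_subset by blast
  then have "card {x, y} \<le> card M"
    using assms(4,5) by (intro card_mono) auto
  with assms show ?thesis
    by (simp add: primitive_def)
qed

lemma constant_on_reachable:
  assumes "\<And>i j. R\<^sup>*\<^sup>* b i \<Longrightarrow> R i j \<Longrightarrow> g i = g j" "R\<^sup>*\<^sup>* b x"
  shows "g x = g b"
  using assms(2,1) by (induction rule: rtranclp_induct) auto

text \<open>No outside vertex separates the ends of an \<open>R\<close>-step, hence none separates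
  two points of a path. Together with primitivity this shows that a reachable set is all of
  \<open>W\<close>.\<close>

lemma clan_reachable:
  assumes "b \<in> W" "\<And>i j. R i j \<Longrightarrow> j \<in> W"
    and "\<And>i j k. R\<^sup>*\<^sup>* b i \<Longrightarrow> R i j \<Longrightarrow> k \<in> W \<Longrightarrow> \<not> R\<^sup>*\<^sup>* b k \<Longrightarrow> f k i = f k j"
  shows "clan W f {x. R\<^sup>*\<^sup>* b x}"
proof -
  have "x \<in> W" if "R\<^sup>*\<^sup>* b x" for x
    using that assms(1,2) by (induction rule: rtranclp_induct) auto
  moreover have "f k x = f k b" if "R\<^sup>*\<^sup>* b x" "k \<in> W" "\<not> R\<^sup>*\<^sup>* b k" for k x
    using assms(3) that by (intro constant_on_reachable[of R b "f k"]) auto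
  ultimately have "f k i = f k j" if "R\<^sup>*\<^sup>* b i" "R\<^sup>*\<^sup>* b j" "k \<in> W" "\<not> R\<^sup>*\<^sup>* b k" for i j k
    using that by metis
  with \<open>\<And>x. R\<^sup>*\<^sup>* b x \<Longrightarrow> x \<in> W\<close> show ?thesis
    unfolding clan_def by blast
qed

text \<open>
  The locale collects what a counterexample would provide; it is shown to be inconsistent.
\<close>

locale Gallai_colouring =
  fixes W :: "'v set" and s :: "'v \<Rightarrow> 'v \<Rightarrow> bool" and w :: "'v \<Rightarrow> 'v \<Rightarrow> 'k::field"
  assumes finite_W: "finite W" and card_W: "card W \<ge> 3"
    and s_sym: "\<And>i j. i \<in> W \<Longrightarrow> j \<in> W \<Longrightarrow> s i j = s j i"
    and w_skew: "\<And>i j. i \<in> W \<Longrightarrow> j \<in> W \<Longrightarrow> w i j = - w j i"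
    and w_neq: "\<And>i j. i \<in> W \<Longrightarrow> j \<in> W \<Longrightarrow> i \<noteq> j \<Longrightarrow> w i j \<noteq> - w i j"
    and forcing: "\<And>k i j. k \<in> W \<Longrightarrow> i \<in> W \<Longrightarrow> j \<in> W \<Longrightarrow> k \<noteq> i \<Longrightarrow> k \<noteq> j \<Longrightarrow> i \<noteq> j \<Longrightarrow>
        s k i = s k j \<Longrightarrow> s i j \<noteq> s k i \<Longrightarrow> w k i = w k j"
    and path4: "\<And>i j k l. i \<in> W \<Longrightarrow> j \<in> W \<Longrightarrow> k \<in> W \<Longrightarrow> l \<in> W \<Longrightarrow> distinct [i, j, k, l] \<Longrightarrow>
        s i j = s j k \<Longrightarrow> s k l = s j k \<Longrightarrow> s i k \<noteq> s j k \<Longrightarrow> s i l \<noteq> s j k \<Longrightarrow> s j l \<noteq> s j k \<Longrightarrow>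
        w i j * w k l = w i k * w j l"
    and primitive_w: "primitive W w"
    and colours: "\<And>c. \<exists>i\<in>W. \<exists>j\<in>W. i \<noteq> j \<and> s i j = c"
begin

section \<open>Connectedness and primitivity of the colouring\<close>

text \<open>Both colour classes are connected: a vertex outside a \<open>c\<close>-component sees
  both ends of each \<open>c\<close>-edge of it in the other colour, so forcing makes the component
  a clan of \<open>w\<close>.\<close>

lemma crossing:
  assumes "M \<subseteq> W" "M \<noteq> {}" "M \<noteq> W"
  shows "\<exists>i\<in>M. \<exists>k\<in>W - M. s i k = c"
proof (rule ccontr)
  assume none: "\<not> ?thesis"
  define R where "R i j \<longleftrightarrow> i \<in> W \<and> j \<in> W \<and> i \<noteq> j \<and> s i j = c" for i j
  obtain a b where ab: "R a b"
    using colours[of c] by (auto simp: R_def)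
  have "clan W w {x. R\<^sup>*\<^sup>* a x}"
  proof (rule clan_reachable)
    fix i j k assume h: "R\<^sup>*\<^sup>* a i" "R i j" "k \<in> W" "\<not> R\<^sup>*\<^sup>* a k"
    then have j: "R\<^sup>*\<^sup>* a j"
      by (meson rtranclp.rtrancl_into_rtrancl)
    have "\<not> R i k" "\<not> R j k" "k \<noteq> i" "k \<noteq> j"
      using h j by (auto intro: rtranclp.rtrancl_into_rtrancl)
    then show "w k i = w k j"
      using h s_sym by (intro forcing) (auto simp: R_def)
  qed (use ab in \<open>auto simp: R_def\<close>)
  moreover have "R\<^sup>*\<^sup>* a b"
    using ab by blast
  ultimately have all: "{x. R\<^sup>*\<^sup>* a x} = W"
    using ab by (intro primitive_clan[OF primitive_w finite_W, of _ a b]) (auto simp: R_def)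
  have "(x \<in> M) = (a \<in> M)" if "R\<^sup>*\<^sup>* a x" for x
    using that
  proof (rule constant_on_reachable[where g = "\<lambda>x. x \<in> M", rotated])
    fix i j assume "R i j"
    then show "(i \<in> M) = (j \<in> M)"
      using none s_sym by (auto simp: R_def)
  qed
  with all assms show False
    by blast
qed

text \<open>A largest proper clan \<open>M\<close> of \<open>s\<close> turns out to be a clan of
  \<open>w\<close>, against \<open>primitive_w\<close>.\<close>

lemma primitive_s: "primitive W s"
proof (rule ccontr)
  assume "\<not> ?thesis"
  then obtain M0 where "clan W s M0 \<and> card M0 \<ge> 2 \<and> M0 \<noteq> W"
    by (auto simp: primitive_def)
  moreover have "\<forall>M. clan W s M \<and> card M \<ge> 2 \<and> M \<noteq> W \<longrightarrow> card M < Suc (card W)"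
    using finite_W by (auto simp: clan_def card_mono less_Suc_eq_le)
  ultimately obtain M where M: "clan W s M" "card M \<ge> 2" "M \<noteq> W"
    and max: "\<And>N. clan W s N \<Longrightarrow> card N \<ge> 2 \<Longrightarrow> N \<noteq> W \<Longrightarrow> card N \<le> card M"
    using ex_has_greatest_nat[of "\<lambda>M. clan W s M \<and> card M \<ge> 2 \<and> M \<noteq> W" M0 card "Suc (card W)"]
    by (metis less_imp_le_nat)
  have MW: "M \<subseteq> W" and Mne: "M \<noteq> {}"
    using M by (auto simp: clan_def)
  have cl: "s k i = s k j" if "k \<in> W" "k \<notin> M" "i \<in> M" "j \<in> M" for i j k
    using M(1) that unfolding clan_def by blast
  have "clan W w M"
    unfolding clan_def
  proof (intro conjI ballI MW)
    fix k i j assume k: "k \<in> W - M" and i: "i \<in> M" and j: "j \<in> M"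
    define c where "c = s k i"
    \<comment> \<open>\<open>K\<close> gathers the outside vertices that see \<open>M\<close> in
      colour \<open>c\<close>; \<open>C\<close> will be the component of \<open>k\<close> in
      \<open>K\<close> under edges of the other colour.\<close>
    define K where "K = {u \<in> W - M. s u i = c}"
    define R where "R u u' \<longleftrightarrow> u \<in> K \<and> u' \<in> K \<and> u \<noteq> u' \<and> s u u' \<noteq> c" for u u'
    define C where "C = {u. R\<^sup>*\<^sup>* k u}"
    have kK: "k \<in> K"
      using k by (simp add: K_def c_def)
    have CK: "C \<subseteq> K"
    proof
      fix u assume "u \<in> C"
      then have "R\<^sup>*\<^sup>* k u" by (simp add: C_def)
      then show "u \<in> K"
        by (induction rule: rtranclp_induct) (auto simp: kK R_def)
    qed
    \<comment> \<open>Forcing at \<open>m\<close>: a step \<open>u u'\<close> has the other colour,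
      while \<open>m u\<close> and \<open>m u'\<close> have colour \<open>c\<close>.\<close>
    have along: "w u m = w k m" if "u \<in> C" "m \<in> M" for u m
    proof -
      have "w m u = w m k"
      proof (rule constant_on_reachable[where g = "w m" and R = R])
        fix u u' assume "R u u'"
        then have h: "u \<in> W" "u \<notin> M" "u' \<in> W" "u' \<notin> M" "s u i = c" "s u' i = c" "s u u' \<noteq> c" "u \<noteq> u'"
          by (auto simp: R_def K_def)
        then have "s u m = c" "s u' m = c"
          using cl that i by blast+
        then show "w m u = w m u'"
          using h that MW s_sym by (intro forcing) auto
      qed (use that in \<open>simp add: C_def\<close>)
      then show ?thesis
        using that CK k MW w_skew[of _ m] unfolding K_def by (metis (no_types, lifting) Diff_iff mem_Collect_eq subsetD)
    qed
    show "w k i = w k j"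
    proof (cases "\<exists>u\<in>C. \<exists>l\<in>W - M - K. s u l = c")
      case True
      then obtain u l where ul: "u \<in> C" "l \<in> W" "l \<notin> M" "l \<notin> K" "s u l = c"
        by blast
      have u: "u \<in> W" "u \<notin> M" "s u i = c" and "u \<noteq> l"
        using ul CK by (auto simp: K_def)
      \<comment> \<open>\<open>l\<close> sees \<open>M\<close> in the colour other than
        \<open>c\<close>, so forcing at \<open>u\<close> equates every \<open>w u m\<close> with the
        single value \<open>w u l\<close>.\<close>
      have "w u m = w u l" if "m \<in> M" for m
      proof (rule forcing)
        show "s u m = s u l" "s m l \<noteq> s u m"
          using cl[OF u(1,2) that i] cl[OF ul(2,3) that i] u ul s_sym[of m l] that MW
          by (auto simp: K_def)
      qed (use that MW u ul in \<open>auto simp: \<open>u \<noteq> l\<close>\<close>)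
      then show ?thesis
        using along[OF ul(1)] i j by metis
    next
      case False
      \<comment> \<open>Without such an edge \<open>u l\<close>, \<open>C\<close> can be added to
        \<open>M\<close>: a vertex of \<open>K - C\<close> sees both in colour \<open>c\<close>, one
        outside \<open>K\<close> sees both in the other colour.\<close>
      have "s m u = s m i" if m: "m \<in> W" "m \<notin> M" "m \<notin> C" and u: "u \<in> M \<union> C" for m u
      proof (cases "u \<in> M")
        case True
        then show ?thesis
          using cl m i by blast
      next
        case uM: False
        then have uC: "u \<in> C" "u \<in> K" "u \<in> W" "u \<noteq> m"
          using u CK m by (auto simp: K_def)
        show ?thesis
        proof (cases "m \<in> K")
          case True
          have "\<not> R u m"
            using uC m by (auto simp: C_def intro: rtranclp.rtrancl_into_rtrancl)
          then show ?thesis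
            using True uC s_sym[of u m] m by (auto simp: R_def K_def)
        next
          case mK: False
          then have "s u m \<noteq> c"
            using False m uC by blast
          then show ?thesis
            using mK m s_sym[of u m] uC by (auto simp: K_def)
        qed
      qed
      then have "clan W s (M \<union> C)"
        using MW CK by (auto simp: clan_def K_def)
      \<comment> \<open>An edge of the other colour leaving \<open>M\<close> ends outside
        \<open>K\<close>, so the larger clan is still proper.\<close>
      moreover obtain m l where "m \<in> M" "l \<in> W - M" "s m l = (\<not> c)"
        using crossing[OF MW Mne M(3), of "\<not> c"] by blast
      then have "l \<notin> M \<union> C" "l \<in> W"
        using CK cl[of l m i] i s_sym[of m l] MW by (auto simp: K_def)
      then have "M \<union> C \<noteq> W"
        by blast
      moreover have fin: "finite (M \<union> C)"
        using \<open>clan W s (M \<union> C)\<close> finite_W by (auto simp: clan_def intro: finite_subset)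
      moreover have "M \<subset> M \<union> C"
        using k by (auto simp: C_def)
      then have "card M < card (M \<union> C)"
        using fin by (simp add: psubset_card_mono)
      ultimately have False
        using max[of "M \<union> C"] M(2) by simp
      then show ?thesis ..
    qed
  qed
  then show False
    using primitive_w M by (simp add: primitive_def)
qed

section \<open>Triangles and the edges of one colour\<close>

text \<open>
  Gallai's triangle lemma: if it failed, the arcs forced by \<open>(b, c)\<close> would span a clan
  all of whose vertices form with \<open>a\<close> a triangle like \<open>a b c\<close>; this clan misses \<open>a\<close>.
\<close>

lemma triangle:
  assumes abc: "a \<in> W" "b \<in> W" "c \<in> W" "a \<noteq> b" "a \<noteq> c" "b \<noteq> c"
    and col: "s a b = e" "s a c = e" "s b c = e"
  shows "w a c = w b c \<or> w b a = w b c"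
proof (rule ccontr)
  assume neg: "\<not> ?thesis"
  define Q where "Q u v \<longleftrightarrow> w u v = w b c \<and> w a u = w a b \<and> w a v = w a c" for u v
  define R where "R u v \<longleftrightarrow> u \<in> W \<and> v \<in> W \<and> u \<noteq> v \<and> a \<noteq> u \<and> a \<noteq> v \<and> s u v = e \<and> s a u = e \<and> s a v = e \<and>
    (Q u v \<or> Q v u)" for u v
  have R_sym: "R u v \<Longrightarrow> R v u" for u v
    using s_sym by (auto simp: R_def)
  have step: "R i k" if R: "R i j" and k: "k \<in> W" "k \<noteq> i" "k \<noteq> j" "k \<noteq> a" "s k i = e" "s k j \<noteq> e" for i j k
  proof -
    have h: "i \<in> W" "j \<in> W" "i \<noteq> j" "a \<noteq> i" "a \<noteq> j" "s i j = e" "s a i = e" "s a j = e" "Q i j \<or> Q j i"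
      using R by (auto simp: R_def)
    have ik: "w i k = w i j"
      using h k s_sym[of i k] s_sym[of k j] by (intro forcing) auto
    \<comment> \<open>The negated conclusion, carried over to the copy \<open>a i j\<close>. It
      excludes the other colour for \<open>a k\<close>, since forcing at \<open>i\<close> would then
      give \<open>w i a = w i k\<close>.\<close>
    have "w i a \<noteq> w i j"
      using h(9) neg w_skew[of i a] w_skew[of b a] w_skew[of i j] h abc
      by (auto simp: Q_def)
    then have ak: "s a k = e"
      using forcing[of i a k] ik h k abc s_sym[of i a] s_sym[of i k] by auto
    then have "w a k = w a j"
      using h k abc s_sym[of k j] by (intro forcing) auto
    moreover have "w k i = w j i"
      using ik w_skew[of k i] w_skew[of j i] h k by simp
    ultimately have "Q i k \<or> Q k i"
      using h(9) ik by (auto simp: Q_def)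
    then show ?thesis
      using h k ak s_sym[of i k] by (auto simp: R_def)
  qed
  have "clan W s {x. R\<^sup>*\<^sup>* b x}"
  proof (rule clan_reachable)
    fix i j k assume h: "R\<^sup>*\<^sup>* b i" "R i j" "k \<in> W" "\<not> R\<^sup>*\<^sup>* b k"
    then have j: "R\<^sup>*\<^sup>* b j"
      by (meson rtranclp.rtrancl_into_rtrancl)
    have n: "\<not> R i k" "\<not> R j k" "k \<noteq> i" "k \<noteq> j"
      using h j by (auto intro: rtranclp.rtrancl_into_rtrancl)
    show "s k i = s k j"
    proof (cases "k = a")
      case True
      then show ?thesis
        using h(2) by (simp add: R_def)
    next
      case False
      then show ?thesis
        using step[of i j k] step[of j i k] R_sym h n by blast
    qed
  qed (use abc in \<open>auto simp: R_def\<close>)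
  moreover have bc: "R b c"
    using abc col by (simp add: R_def Q_def)
  then have "R\<^sup>*\<^sup>* b c" by blast
  ultimately have "{x. R\<^sup>*\<^sup>* b x} = W"
    using abc by (intro primitive_clan[OF primitive_s finite_W, of _ b c]) auto
  then have "R\<^sup>*\<^sup>* b a"
    using abc by auto
  moreover have "x \<noteq> a" if "R\<^sup>*\<^sup>* b x" for x
    using that by (induction rule: rtranclp_induct) (use abc in \<open>auto simp: R_def\<close>)
  ultimately show False
    by blast
qed

text \<open>Some vertex of the triangle has two edges of one colour. If the third edge differs,
  forcing there equates a value with its negative; in a monochromatic triangle
  \<open>triangle\<close> does so. Both contradict \<open>w_neq\<close>.\<close>

lemma not_cyclic:
  assumes abc: "a \<in> W" "b \<in> W" "c \<in> W" "a \<noteq> b" "a \<noteq> c" "b \<noteq> c"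
    and cyc: "w a b = w b c" "w b c = w c a"
  shows False
proof -
  have sym: "s b a = s a b" "s c a = s a c" "s c b = s b c"
    using s_sym abc by blast+
  have sk: "w b a = - w a b" "w c b = - w b c" "w a c = - w c a"
    using w_skew abc by blast+
  have nq: "w b c \<noteq> - w b c"
    using w_neq abc by auto
  consider "s a b = s a c" "s b c \<noteq> s a b" | "s b a = s b c" "s a c \<noteq> s b a" | "s c a = s c b" "s a b \<noteq> s c a"
    | "s a b = s a c" "s b c = s a b"
    using sym by blast
  then show False
  proof cases
    case 1
    then show False using forcing[of a b c] abc cyc sk nq by auto
  next
    case 2
    then show False using forcing[of b a c] abc cyc sk nq by auto
  next
    case 3
    then show False using forcing[of c a b] abc cyc sk nq by auto
  next
    case 4
    then show False using triangle[of a b c "s a b"] abc cyc sk nq by metis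
  qed
qed

lemma adjacent_edges:
  assumes abc: "a \<in> W" "b \<in> W" "c \<in> W" "a \<noteq> b" "a \<noteq> c"
    and col: "s a b = s a c"
  shows "w a b = w a c \<or> w a b = - w a c"
proof (cases "b = c \<or> s b c \<noteq> s a b")
  case True
  then show ?thesis
    using forcing[of a b c] assms by auto
next
  case False
  have sym: "s b a = s a b" "s c a = s a c" "s c b = s b c"
    using s_sym abc by blast+
  have sk: "w b a = - w a b" "w c b = - w b c" "w c a = - w a c"
    using w_skew abc by blast+
  \<comment> \<open>By \<open>triangle\<close> at each corner, each of the three values agrees up to
    sign with another one; hence all three agree up to sign.\<close>
  have 1: "w a c = w b c \<or> w b a = w b c"
    using False abc col by (intro triangle[where e = "s a b"]) auto
  have 2: "w b a = w c a \<or> w c b = w c a"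
    using False abc col sym by (intro triangle[where e = "s a b"]) auto
  have 3: "w c b = w a b \<or> w a c = w a b"
    using False abc col sym by (intro triangle[where e = "s a b"]) auto
  show ?thesis
    using 1 2 3 sk by (metis minus_minus)
qed

text \<open>Connectedness of the colour class spreads \<open>adjacent_edges\<close>:
  \<open>crossing\<close> supplies an edge leaving the set \<open>M\<close> of vertices already
  settled.\<close>

lemma edges_of_colour:
  assumes ab: "a \<in> W" "b \<in> W" "a \<noteq> b" and ij: "i \<in> W" "j \<in> W" "i \<noteq> j" "s i j = s a b"
  shows "w i j = w a b \<or> w i j = - w a b"
proof -
  define M where "M = {u \<in> W. \<forall>v\<in>W. u \<noteq> v \<longrightarrow> s u v = s a b \<longrightarrow> w u v = w a b \<or> w u v = - w a b}"
  have "a \<in> M"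
    using ab adjacent_edges[of a _ b] by (auto simp: M_def)
  have "M = W"
  proof (rule ccontr)
    assume "M \<noteq> W"
    then obtain u v where uv: "u \<in> M" "v \<in> W - M" "s u v = s a b"
      using crossing[of M "s a b"] \<open>a \<in> M\<close> by (auto simp: M_def)
    then have u: "u \<in> W" "u \<noteq> v"
      by (auto simp: M_def)
    have "w u v = w a b \<or> w u v = - w a b"
      using uv u unfolding M_def by blast
    then have vu: "w v u = w a b \<or> w v u = - w a b"
      using w_skew[of v u] u uv by auto
    have "w v x = w a b \<or> w v x = - w a b" if "x \<in> W" "v \<noteq> x" "s v x = s a b" for x
      using adjacent_edges[of v x u] vu that u uv s_sym[of v u] by auto
    then show False
      using uv by (auto simp: M_def)
  qed
  then show ?thesis
    using ij by (auto simp: M_def)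
qed

section \<open>Four-vertex paths linking the two colours\<close>

text \<open>By \<open>crossing\<close> a vertex \<open>u\<close> has an edge of each colour; the
  edge joining their ends agrees with one of them.\<close>

lemma mixed_triple:
  obtains v d d' where "v \<in> W" "d \<in> W" "d' \<in> W" "v \<noteq> d" "v \<noteq> d'" "d \<noteq> d'"
    "s v d = s v d'" "s d d' \<noteq> s v d"
proof -
  obtain u where u: "u \<in> W"
    using card_W by fastforce
  have "{u} \<noteq> W"
    using card_W by auto
  then obtain k l where kl: "k \<in> W" "k \<noteq> u" "s u k" "l \<in> W" "l \<noteq> u" "\<not> s u l"
    using crossing[of "{u}" True] crossing[of "{u}" False] u by auto
  then have "k \<noteq> l" by blast
  show thesis
  proof (cases "s k l")
    case True
    then show thesis
      using that[of k u l] kl u s_sym[of u k] \<open>k \<noteq> l\<close> by auto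
  next
    case False
    then show thesis
      using that[of l u k] kl u s_sym[of u l] s_sym[of k l] \<open>k \<noteq> l\<close> by auto
  qed
qed

text \<open>Take a component of the \<open>e\<close>-edges among the vertices joined to
  \<open>v\<close> in the other colour. Primitivity of \<open>s\<close> keeps it from being a clan,
  and a vertex splitting one of its edges completes an induced path \<open>v k i j\<close>.\<close>

lemma exists_path4:
  obtains v k i j where "v \<in> W" "k \<in> W" "i \<in> W" "j \<in> W" "distinct [v, k, i, j]"
    "s v k = s k i" "s i j = s k i" "s v i \<noteq> s k i" "s v j \<noteq> s k i" "s k j \<noteq> s k i"
proof -
  obtain v d d' where v: "v \<in> W" "d \<in> W" "d' \<in> W" "v \<noteq> d" "v \<noteq> d'" "d \<noteq> d'"
    "s v d = s v d'" "s d d' \<noteq> s v d"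
    by (rule mixed_triple)
  define e where "e = s d d'"
  define R where "R i j \<longleftrightarrow> i \<in> W \<and> j \<in> W \<and> i \<noteq> j \<and> i \<noteq> v \<and> j \<noteq> v \<and> s i j = e \<and> s v i \<noteq> e \<and> s v j \<noteq> e" for i j
  have R_sym: "R i j \<Longrightarrow> R j i" for i j
    using s_sym[of i j] by (auto simp: R_def)
  have R: "R d d'"
    using v by (auto simp: R_def e_def)
  have nv: "x \<noteq> v" if "R\<^sup>*\<^sup>* d x" for x
    using that by (induction rule: rtranclp_induct) (use v in \<open>auto simp: R_def\<close>)
  have "\<exists>i j k. R i j \<and> k \<in> W \<and> k \<noteq> i \<and> k \<noteq> j \<and> \<not> R i k \<and> s k i = e \<and> s k j \<noteq> e"
  proof (rule ccontr)
    assume none: "\<not> ?thesis"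
    have "clan W s {x. R\<^sup>*\<^sup>* d x}"
    proof (rule clan_reachable)
      fix i j k assume h: "R\<^sup>*\<^sup>* d i" "R i j" "k \<in> W" "\<not> R\<^sup>*\<^sup>* d k"
      then have j: "R\<^sup>*\<^sup>* d j"
        by (meson rtranclp.rtrancl_into_rtrancl)
      have n: "\<not> R i k" "\<not> R j k" "k \<noteq> i" "k \<noteq> j"
        using h j by (auto intro: rtranclp.rtrancl_into_rtrancl)
      show "s k i = s k j"
        using none h n R_sym by blast
    qed (use v in \<open>auto simp: R_def\<close>)
    then have "{x. R\<^sup>*\<^sup>* d x} = W"
      using R v by (intro primitive_clan[OF primitive_s finite_W, of _ d d']) auto
    then show False
      using nv v by blast
  qed
  then obtain i j k where h: "R i j" "k \<in> W" "k \<noteq> i" "k \<noteq> j" "\<not> R i k" "s k i = e" "s k j \<noteq> e"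
    by blast
  \<comment> \<open>The edge \<open>v k\<close> has colour \<open>e\<close>, since otherwise
    \<open>R i k\<close> would hold.\<close>
  then have "k \<noteq> v" and "s v k = e"
    using s_sym[of k i] by (auto simp: R_def)
  with h v show thesis
    by (intro that[of v k i j]) (auto simp: R_def)
qed

text \<open>On the path of \<open>exists_path4\<close>, forcing gives \<open>w v k = w i j\<close>
  and \<open>w v i = w k j\<close>, so \<open>path4\<close> equates two squares, one from each
  colour.\<close>

lemma entries_up_to_sign:
  obtains x where "\<And>i j. i \<in> W \<Longrightarrow> j \<in> W \<Longrightarrow> i \<noteq> j \<Longrightarrow> w i j = x \<or> w i j = - x"
proof -
  obtain v k i j where h: "v \<in> W" "k \<in> W" "i \<in> W" "j \<in> W" "distinct [v, k, i, j]"
    "s v k = s k i" "s i j = s k i" "s v i \<noteq> s k i" "s v j \<noteq> s k i" "s k j \<noteq> s k i"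
    by (rule exists_path4)
  have sym: "s k v = s v k" "s i k = s k i" "s j i = s i j" "s j v = s v j" "s j k = s k j"
    using h(1-4) s_sym by blast+
  have "w v i = w v j"
    using h by (intro forcing) auto
  moreover have "w j v = w j k"
    using h sym by (intro forcing) auto
  moreover have "w k v = w k i"
    using h sym by (intro forcing) auto
  moreover have "w i k = w i j"
    using h sym by (intro forcing) auto
  moreover have "w j v = - w v j" "w j k = - w k j" "w k v = - w v k" "w i k = - w k i"
    using h(1-4) w_skew by blast+
  ultimately have "w v k = w i j" "w v i = w k j"
    by (metis minus_minus)+
  moreover have "w v k * w i j = w v i * w k j"
    using h by (intro path4) auto
  ultimately have "w v k * w v k = w v i * w v i"
    by simp
  then have vi: "w v i = w v k \<or> w v i = - w v k"
    by (metis square_eq_iff)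
  show thesis
  proof (rule that[of "w v k"])
    fix p q assume pq: "p \<in> W" "q \<in> W" "p \<noteq> q"
    show "w p q = w v k \<or> w p q = - w v k"
    proof (cases "s p q = s v k")
      case True
      then show ?thesis
        using edges_of_colour[of v k p q] h pq by auto
    next
      case False
      then have "s p q = s v i"
        using h by auto
      then show ?thesis
        using edges_of_colour[of v i p q] h pq vi by auto
    qed
  qed
qed

lemma absurd_colouring: False
proof -
  obtain x where x: "\<And>i j. i \<in> W \<Longrightarrow> j \<in> W \<Longrightarrow> i \<noteq> j \<Longrightarrow> w i j = x \<or> w i j = - x"
    using entries_up_to_sign by blast
  define out where "out m = {j \<in> W. j \<noteq> m \<and> w m j = x}" for m
  have fin: "finite (out m)" for m
    using finite_W by (simp add: out_def)
  have ne: "W \<noteq> {}"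
    using card_W by auto
  then obtain m where m: "m \<in> W" and max: "\<And>k. k \<in> W \<Longrightarrow> card (out k) \<le> card (out m)"
  proof -
    have "Max ((\<lambda>k. card (out k)) ` W) \<in> (\<lambda>k. card (out k)) ` W"
      using ne finite_W by (intro Max_in) auto
    then obtain m where "m \<in> W" "card (out m) = Max ((\<lambda>k. card (out k)) ` W)"
      by auto
    then show thesis
      using that finite_W by auto
  qed
  have src: "w m k = x" if k: "k \<in> W" "k \<noteq> m" for k
  proof (rule ccontr)
    assume "w m k \<noteq> x"
    then have km: "w k m = x"
      using x[of m k] w_skew[of k m] m k by auto
    \<comment> \<open>Otherwise \<open>k m j\<close> would be a cyclic triangle. Hence
      \<open>out k\<close> contains \<open>out m\<close> together with \<open>m\<close>, against
      maximality.\<close>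
    have "w k j = x" if j: "j \<in> out m" for j
    proof (rule ccontr)
      assume "w k j \<noteq> x"
      moreover have "j \<noteq> k"
        using j \<open>w m k \<noteq> x\<close> by (auto simp: out_def)
      ultimately have "w j k = x"
        using x[of k j] w_skew[of j k] k j by (auto simp: out_def)
      then show False
        using not_cyclic[of k m j] k j m km \<open>j \<noteq> k\<close> by (auto simp: out_def)
    qed
    then have "insert m (out m) \<subseteq> out k"
      using km m k \<open>w m k \<noteq> x\<close> by (auto simp: out_def)
    then have "card (insert m (out m)) \<le> card (out k)"
      using fin by (intro card_mono) auto
    then show False
      using max[OF k(1)] fin by (simp add: out_def)
  qed
  have "clan W w (W - {m})"
    using src by (auto simp: clan_def)
  then have "W - {m} = W"
    using primitive_w card_W m finite_W by (auto simp: primitive_def)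
  with m show False
    by blast
qed

end

subsection \<open>Minors of order two and four\<close>

text \<open>The minors on the right have the shape of the left side again, so rewriting expands a
  determinant of fixed size completely.\<close>

lemma det_laplace_first_row:
  fixes f :: "nat \<Rightarrow> nat \<Rightarrow> 'k::comm_ring_1"
  shows "det (mat (Suc n) (Suc n) (\<lambda>(i, j). f i j)) =
    (\<Sum>j<Suc n. f 0 j * (- 1) ^ j * det (mat n n (\<lambda>(i, l). f (Suc i) (if l < j then l else Suc l))))"
proof -
  have del: "mat_delete (mat (Suc n) (Suc n) (\<lambda>(i, j). f i j)) 0 j =
      mat n n (\<lambda>(i, l). f (Suc i) (if l < j then l else Suc l))" for j
    by (rule eq_matI) (auto simp: mat_delete_def)
  show ?thesis
    by (subst laplace_expansion_row[of _ "Suc n" 0])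
      (auto simp: cofactor_def del mult.assoc intro!: sum.cong)
qed

lemma det_skew_2:
  fixes f :: "nat \<Rightarrow> nat \<Rightarrow> 'k::comm_ring_1"
  assumes "\<And>i. i < 2 \<Longrightarrow> f i i = 0" "f 1 0 = - f 0 1"
  shows "det (mat 2 2 (\<lambda>(i, j). f i j)) = (f 0 1)\<^sup>2"
  using assms(1)[of 0] assms(1)[of 1] assms(2)
  by (simp add: det_laplace_first_row numeral_2_eq_2)

text \<open>Cayley's identity for the Pfaffian, checked by full expansion. The zero diagonal is a
  separate hypothesis because skew-symmetry yields it only where 2 can be cancelled.\<close>

lemma det_skew_4:
  fixes f :: "nat \<Rightarrow> nat \<Rightarrow> 'k::comm_ring_1"
  assumes "\<And>i. i < 4 \<Longrightarrow> f i i = 0" "\<And>i j. i < 4 \<Longrightarrow> j < 4 \<Longrightarrow> f j i = - f i j"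
  shows "det (mat 4 4 (\<lambda>(i, j). f i j)) = (f 0 1 * f 2 3 - f 0 2 * f 1 3 + f 0 3 * f 1 2)\<^sup>2"
proof -
  have 4: "(4::nat) = Suc (Suc (Suc (Suc 0)))" by simp
  have d: "f 0 0 = 0" "f (Suc 0) (Suc 0) = 0" "f (Suc (Suc 0)) (Suc (Suc 0)) = 0"
     "f (Suc (Suc (Suc 0))) (Suc (Suc (Suc 0))) = 0"
    using assms(1) by simp_all
  have s: "f (Suc 0) 0 = - f 0 (Suc 0)" "f (Suc (Suc 0)) 0 = - f 0 (Suc (Suc 0))"
    "f (Suc (Suc (Suc 0))) 0 = - f 0 (Suc (Suc (Suc 0)))"
    "f (Suc (Suc 0)) (Suc 0) = - f (Suc 0) (Suc (Suc 0))"
    "f (Suc (Suc (Suc 0))) (Suc 0) = - f (Suc 0) (Suc (Suc (Suc 0)))"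
    "f (Suc (Suc (Suc 0))) (Suc (Suc 0)) = - f (Suc (Suc 0)) (Suc (Suc (Suc 0)))"
    by (rule assms(2); simp)+
  have "det (mat 4 4 (\<lambda>(i, j). f i j)) =
      (f 0 (Suc 0) * f (Suc (Suc 0)) (Suc (Suc (Suc 0))) - f 0 (Suc (Suc 0)) * f (Suc 0) (Suc (Suc (Suc 0)))
       + f 0 (Suc (Suc (Suc 0))) * f (Suc 0) (Suc (Suc 0)))\<^sup>2"
    unfolding 4
    by (simp add: det_laplace_first_row d s, simp add: algebra_simps power2_eq_square)
  then show ?thesis
    by (simp add: numeral_2_eq_2 numeral_3_eq_3)
qed

definition pfaffian4 :: "('v \<Rightarrow> 'v \<Rightarrow> 'k::comm_ring_1) \<Rightarrow> 'v \<Rightarrow> 'v \<Rightarrow> 'v \<Rightarrow> 'v \<Rightarrow> 'k" where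
  "pfaffian4 A i j k l = A i j * A k l - A i k * A j l + A i l * A j k"

lemma from_nat_into_card_2:
  assumes "i \<noteq> j"
  shows "from_nat_into {i, j} 0 = i \<and> from_nat_into {i, j} 1 = j \<or>
    from_nat_into {i, j} 0 = j \<and> from_nat_into {i, j} 1 = i"
proof -
  have "bij_betw (from_nat_into {i, j}) {..<card {i, j}} {i, j}"
    by (rule bij_betw_from_nat_into_finite) simp
  then have "inj_on (from_nat_into {i, j}) {0, 1}" "from_nat_into {i, j} ` {0, 1} = {i, j}"
    using assms by (auto simp: bij_betw_def numeral_2_eq_2 lessThan_Suc insert_commute)
  then show ?thesis
    by (auto simp: inj_on_def doubleton_eq_iff)
qed

lemma det_submat_2:
  fixes A :: "'v \<Rightarrow> 'v \<Rightarrow> 'k::comm_ring_1"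
  assumes "i \<noteq> j" "A i i = 0" "A j j = 0" "A j i = - A i j"
  shows "det (submat A {i, j} {i, j}) = (A i j)\<^sup>2"
proof -
  define e where "e = from_nat_into {i, j}"
  have e: "e 0 = i \<and> e 1 = j \<or> e 0 = j \<and> e 1 = i"
    using from_nat_into_card_2[OF assms(1)] by (simp add: e_def)
  have c: "card {i, j} = 2"
    using assms by simp
  have "det (submat A {i, j} {i, j}) = (A (e 0) (e 1))\<^sup>2"
    unfolding submat_def c e_def[symmetric]
    by (rule det_skew_2) (use e assms in \<open>auto simp: less_2_cases_iff\<close>)
  then show ?thesis
    using e assms by auto
qed

text \<open>The enumeration may list the vertices in any order; reordering changes the Pfaffian at
  most by a sign, which the square absorbs.\<close>

lemma det_submat_4:
  fixes A :: "'v \<Rightarrow> 'v \<Rightarrow> 'k::comm_ring_1"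
  assumes "distinct [i, j, k, l]"
    and diag: "\<And>x. x \<in> {i, j, k, l} \<Longrightarrow> A x x = 0"
    and skew: "\<And>x y. x \<in> {i, j, k, l} \<Longrightarrow> y \<in> {i, j, k, l} \<Longrightarrow> A y x = - A x y"
  shows "det (submat A {i, j, k, l} {i, j, k, l}) = (pfaffian4 A i j k l)\<^sup>2"
proof -
  define e where "e = from_nat_into {i, j, k, l}"
  have c: "card {i, j, k, l} = 4"
    using assms(1) by simp
  have bij: "bij_betw e {..<4} {i, j, k, l}"
    unfolding e_def using bij_betw_from_nat_into_finite[of "{i, j, k, l}"] c by simp
  have mem: "e n \<in> {i, j, k, l}" if "n < 4" for n
    using bij that by (auto simp: bij_betw_def)
  have "e m \<noteq> e n" if "m < 4" "n < 4" "m \<noteq> n" for m n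
    using bij that by (auto simp: bij_betw_def dest: inj_onD)
  then have d: "distinct [e 0, e 1, e 2, e 3]"
    by simp
  have det: "det (submat A {i, j, k, l} {i, j, k, l}) = (pfaffian4 A (e 0) (e 1) (e 2) (e 3))\<^sup>2"
    unfolding submat_def c e_def[symmetric] pfaffian4_def
    by (rule det_skew_4) (assumption | rule mem diag skew)+
  have sk: "A j i = - A i j" "A k i = - A i k" "A l i = - A i l" "A k j = - A j k" "A l j = - A j l" "A l k = - A k l"
    by (rule skew; simp)+
  have "e 0 \<in> {i, j, k, l}" "e 1 \<in> {i, j, k, l}" "e 2 \<in> {i, j, k, l}" "e 3 \<in> {i, j, k, l}"
    by (rule mem; simp)+
  then show ?thesis
    unfolding det pfaffian4_def using d
    by (elim insertE emptyE; simp add: sk; simp add: power2_eq_square algebra_simps)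
qed

section \<open>Rank-one blocks and diagonal conjugation\<close>

lemma rank_submat_le_1:
  fixes A :: "'v \<Rightarrow> 'v \<Rightarrow> 'k::field"
  assumes "finite X" "finite Y" "\<And>x y. x \<in> X \<Longrightarrow> y \<in> Y \<Longrightarrow> A x y = f x * g y"
  shows "vec_space.rank (card X) (submat A X Y) \<le> 1"
proof (rule vec_space.rank_le_1_product_entries)
  show "submat A X Y \<in> carrier_mat (card X) (card Y)"
    by (simp add: submat_def)
  fix r c assume "r < dim_row (submat A X Y)" "c < dim_col (submat A X Y)"
  then have rc: "r < card X" "c < card Y"
    by (simp_all add: submat_def)
  then have "from_nat_into X r \<in> X" "from_nat_into Y c \<in> Y"
    by (metis card.empty from_nat_into less_nat_zero_code)+
  then show "submat A X Y $$ (r, c) = f (from_nat_into X r) * g (from_nat_into Y c)"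
    using rc assms(3) by (simp add: submat_def)
qed

lemma diag_submat_mult:
  fixes A :: "'v \<Rightarrow> 'v \<Rightarrow> 'k::comm_ring_1"
  assumes "finite V"
  shows "submat (diag_matrix d) V V * submat A V V * submat (diag_matrix d) V V =
    submat (\<lambda>i j. d i * A i j * d j) V V"
proof -
  define e where "e = from_nat_into V"
  define n where "n = card V"
  have inj: "inj_on e {..<n}"
    using bij_betw_from_nat_into_finite[OF assms] by (simp add: bij_betw_def e_def n_def)
  have D: "diag_matrix d (e i) (e j) = (if i = j then d (e i) else 0)" if "i < n" "j < n" for i j
    using inj that by (auto simp: diag_matrix_def inj_on_def)
  show ?thesis
    unfolding submat_def e_def[symmetric] n_def[symmetric]
    by (rule eq_matI)
      (auto simp: scalar_prod_def D if_distrib if_distribR sum.delta cong: if_cong)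
qed

text \<open>The diagonal factor squares to the identity, as \<open>diag_submat_mult\<close> with the
  identity in the middle shows; so its determinant squares to 1.\<close>

lemma det_diag_conjugate:
  fixes A :: "'v \<Rightarrow> 'v \<Rightarrow> 'k::field"
  assumes "finite V" "\<And>i. i \<in> V \<Longrightarrow> d i \<in> {-1, 1}"
  shows "det (submat (diag_matrix d) V V * submat A V V * submat (diag_matrix d) V V) = det (submat A V V)"
proof -
  let ?D = "submat (diag_matrix d) V V" and ?I = "submat (diag_matrix (\<lambda>_. 1)) V V"
  define n where "n = card V"
  have car: "submat M V V \<in> carrier_mat n n" for M :: "'v \<Rightarrow> 'v \<Rightarrow> 'k"
    by (simp add: submat_def n_def)
  have mem: "from_nat_into V i \<in> V" if "i < card V" for i
    using that by (metis card.empty from_nat_into less_nat_zero_code)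
  have inj: "inj_on (from_nat_into V) {..<n}"
    using bij_betw_from_nat_into_finite[OF assms(1)] by (simp add: bij_betw_def n_def)
  have one: "?I = 1\<^sub>m n"
    using inj by (intro eq_matI) (auto simp: submat_def n_def diag_matrix_def inj_on_def)
  have "?D * ?D = ?D * ?I * ?D"
    by (simp only: one right_mult_one_mat[OF car])
  also have "\<dots> = submat (\<lambda>i j. d i * diag_matrix (\<lambda>_. 1) i j * d j) V V"
    by (rule diag_submat_mult[OF assms(1)])
  also have "\<dots> = ?I"
    using assms(2)[OF mem] by (intro eq_matI) (fastforce simp: submat_def diag_matrix_def)+
  finally have "det ?D * det ?D = 1"
    using det_mult[OF car car, of "diag_matrix d" "diag_matrix d"] one by (metis det_one)
  moreover have "det (?D * submat A V V * ?D) = det ?D * det (submat A V V) * det ?D"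
    using det_mult[OF mult_carrier_mat[OF car car] car] det_mult[OF car car] by metis
  ultimately show ?thesis
    by (simp add: algebra_simps)
qed

subsection \<open>Sign patterns\<close>

text \<open>\<open>pair\<close>, \<open>triple\<close> and \<open>quad\<close> are the minors of
  order 2 and 4 after the row of a deleted vertex is scaled to ones; \<open>triple\<close> is the
  Pfaffian on that vertex and three others. If both alternatives fail, both signs occur and
  \<open>Gallai_colouring\<close> applies.\<close>

lemma sign_dichotomy:
  fixes w u :: "'v \<Rightarrow> 'v \<Rightarrow> 'k::field"
  assumes W: "finite W" "card W \<ge> 3" and two: "(2::'k) \<noteq> 0"
    and w_skew: "\<And>i j. i \<in> W \<Longrightarrow> j \<in> W \<Longrightarrow> w i j = - w j i"
    and u_skew: "\<And>i j. i \<in> W \<Longrightarrow> j \<in> W \<Longrightarrow> u i j = - u j i"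
    and w_nz: "\<And>i j. i \<in> W \<Longrightarrow> j \<in> W \<Longrightarrow> i \<noteq> j \<Longrightarrow> w i j \<noteq> 0"
    and pair: "\<And>i j. i \<in> W \<Longrightarrow> j \<in> W \<Longrightarrow> i \<noteq> j \<Longrightarrow> (u i j)\<^sup>2 = (w i j)\<^sup>2"
    and triple: "\<And>i j k. i \<in> W \<Longrightarrow> j \<in> W \<Longrightarrow> k \<in> W \<Longrightarrow> distinct [i, j, k] \<Longrightarrow>
      (u j k - u i k + u i j)\<^sup>2 = (w j k - w i k + w i j)\<^sup>2"
    and quad: "\<And>i j k l. i \<in> W \<Longrightarrow> j \<in> W \<Longrightarrow> k \<in> W \<Longrightarrow> l \<in> W \<Longrightarrow> distinct [i, j, k, l] \<Longrightarrow>
      (pfaffian4 u i j k l)\<^sup>2 = (pfaffian4 w i j k l)\<^sup>2"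
    and prim: "primitive W w"
  shows "(\<forall>i\<in>W. \<forall>j\<in>W. i \<noteq> j \<longrightarrow> u i j = w i j) \<or> (\<forall>i\<in>W. \<forall>j\<in>W. i \<noteq> j \<longrightarrow> u i j = - w i j)"
proof (rule ccontr)
  assume mixed: "\<not> ?thesis"
  define s where "s i j \<longleftrightarrow> u i j = w i j" for i j
  \<comment> \<open>Used with \<open>z\<close> the only Pfaffian term whose relative sign differs
    between \<open>u\<close> and \<open>w\<close>.\<close>
  have cancel: "x = 0" if "(x - z)\<^sup>2 = (x + z)\<^sup>2" "z \<noteq> 0" for x z :: 'k
  proof -
    have "2 * 2 * (z * x) = (x + z)\<^sup>2 - (x - z)\<^sup>2"
      by (simp add: power2_eq_square algebra_simps)
    then show ?thesis
      using that two by (metis cancel_comm_monoid_add_class.diff_cancel mult_eq_0_iff)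
  qed
  have su: "u i j = (if s i j then w i j else - w i j)" if "i \<in> W" "j \<in> W" "i \<noteq> j" for i j
    using pair[OF that] by (auto simp: s_def power2_eq_iff)
  have neq: "w i j \<noteq> - w i j" if "i \<in> W" "j \<in> W" "i \<noteq> j" for i j
  proof
    assume "w i j = - w i j"
    then have "2 * w i j = 0"
      by (metis add.right_inverse mult_2)
    then show False
      using two w_nz[OF that] by simp
  qed
  interpret Gallai_colouring W s w
  proof
    show "finite W" "3 \<le> card W" "primitive W w"
      using W prim by simp_all
    show "s i j = s j i" if "i \<in> W" "j \<in> W" for i j
      using w_skew[OF that] u_skew[OF that] by (simp add: s_def)
    show "w i j = - w j i" if "i \<in> W" "j \<in> W" for i j
      using w_skew that .
    show "w i j \<noteq> - w i j" if "i \<in> W" "j \<in> W" "i \<noteq> j" for i j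
      using neq that .
    show "\<exists>i\<in>W. \<exists>j\<in>W. i \<noteq> j \<and> s i j = c" for c
    proof -
      obtain a b where ab: "a \<in> W" "b \<in> W" "a \<noteq> b" "u a b \<noteq> w a b"
        using mixed by blast
      obtain a' b' where ab': "a' \<in> W" "b' \<in> W" "a' \<noteq> b'" "u a' b' \<noteq> - w a' b'"
        using mixed by blast
      have "\<not> s a b" "s a' b'"
        using ab ab' su[of a' b'] by (auto simp: s_def split: if_splits)
      then show ?thesis
        using ab ab' by (cases c) blast+
    qed
  next
    fix k i j assume h: "k \<in> W" "i \<in> W" "j \<in> W" "k \<noteq> i" "k \<noteq> j" "i \<noteq> j" "s k i = s k j" "s i j \<noteq> s k i"
    have "(u i j - u k j + u k i)\<^sup>2 = (w k i - w k j - w i j)\<^sup>2"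
    proof (cases "s k i")
      case True
      then have "u i j - u k j + u k i = w k i - w k j - w i j"
        using su h by simp
      then show ?thesis by simp
    next
      case False
      then have "u i j - u k j + u k i = - (w k i - w k j - w i j)"
        using su h by simp
      then show ?thesis by (simp only: power2_minus)
    qed
    moreover have "(u i j - u k j + u k i)\<^sup>2 = (w i j - w k j + w k i)\<^sup>2"
      using h by (intro triple) auto
    ultimately have "(w k i - w k j - w i j)\<^sup>2 = (w k i - w k j + w i j)\<^sup>2"
      by (simp add: algebra_simps)
    then show "w k i = w k j"
      using cancel w_nz h by (metis right_minus_eq)
  next
    fix i j k l
    assume h: "i \<in> W" "j \<in> W" "k \<in> W" "l \<in> W" "distinct [i, j, k, l]"
      "s i j = s j k" "s k l = s j k" "s i k \<noteq> s j k" "s i l \<noteq> s j k" "s j l \<noteq> s j k"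
    \<comment> \<open>\<open>i j\<close> and \<open>k l\<close> share a colour, as do
      \<open>i k\<close> and \<open>j l\<close>; only the pair \<open>i l\<close>,
      \<open>j k\<close> is mixed.\<close>
    have "u i j * u k l = w i j * w k l" "u i k * u j l = w i k * w j l" "u i l * u j k = - (w i l * w j k)"
      using h su by (cases "s j k"; auto)+
    then have "(w i j * w k l - w i k * w j l - w i l * w j k)\<^sup>2 =
        (w i j * w k l - w i k * w j l + w i l * w j k)\<^sup>2"
      using quad[OF h(1-5)] by (simp add: pfaffian4_def)
    moreover have "w i l * w j k \<noteq> 0"
      using w_nz h by auto
    ultimately show "w i j * w k l = w i k * w j l"
      using cancel by (metis right_minus_eq)
  qed
  show False
    by (rule absurd_colouring)
qed

text \<open>For a proper clan \<open>M\<close> the columns of \<open>A\<close> over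
  \<open>V - M\<close> indexed by \<open>M\<close> are multiples of one vector, so both off-diagonal
  blocks have rank at most 1.\<close>

lemma HL_indecomposable_imp_primitive:
  fixes A :: "'v \<Rightarrow> 'v \<Rightarrow> 'k::field"
  assumes V: "finite V" "v \<in> V"
    and skew: "\<And>i j. i \<in> V \<Longrightarrow> j \<in> V \<Longrightarrow> A j i = - A i j"
    and nz: "\<And>i. i \<in> V - {v} \<Longrightarrow> A v i \<noteq> 0"
    and HL: "HL_indecomposable V A"
  shows "primitive (V - {v}) (\<lambda>i j. A i j / (A v i * A v j))"
  unfolding primitive_def
proof (intro allI impI, rule ccontr)
  fix M assume M: "clan (V - {v}) (\<lambda>i j. A i j / (A v i * A v j)) M" "2 \<le> card M" "M \<noteq> V - {v}"
  then obtain i0 where i0: "i0 \<in> M"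
    by fastforce
  have MV: "M \<subseteq> V - {v}"
    using M by (simp add: clan_def)
  then have finM: "finite M"
    using V(1) by (meson Diff_subset finite_subset)
  \<comment> \<open>\<open>v\<close> and \<open>l\<close> are the two vertices outside
    \<open>M\<close> that the size condition demands.\<close>
  obtain l where l: "l \<in> V" "l \<noteq> v" "l \<notin> M"
    using M(3) MV by blast
  \<comment> \<open>The value 1 at \<open>v\<close> lets \<open>g\<close> cover the row of
    \<open>v\<close> too.\<close>
  define g where "g k = (if k = v then 1 else A k i0 / A v i0)" for k
  have ent: "A k i = g k * A v i" if "i \<in> M" "k \<in> V - M" for i k
  proof (cases "k = v")
    case False
    then have "A k i / (A v k * A v i) = A k i0 / (A v k * A v i0)"
      using M(1) that i0 unfolding clan_def by blast
    moreover have "A v k \<noteq> 0" "A v i \<noteq> 0" "A v i0 \<noteq> 0"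
      using nz that i0 MV False by auto
    ultimately show ?thesis
      using False by (simp add: g_def field_simps)
  qed (simp add: g_def)
  have "vec_space.rank (card (V - M)) (submat A (V - M) M) \<le> 1"
    using V MV ent by (intro rank_submat_le_1[where f = g and g = "A v"]) (auto intro: finite_subset)
  moreover have "A i k = A v i * - g k" if "i \<in> M" "k \<in> V - M" for i k
    using ent[OF that] skew[of k i] that MV by auto
  then have "vec_space.rank (card M) (submat A M (V - M)) \<le> 1"
    using V MV by (intro rank_submat_le_1[where f = "A v" and g = "\<lambda>k. - g k"]) (auto intro: finite_subset)
  moreover have "card M + 2 \<le> card V"
  proof -
    have "card {v, l} \<le> card (V - M)"
      using V l MV by (intro card_mono) auto
    moreover have "card (V - M) + card M = card V"
      using card_Diff_subset[OF finM] card_mono[OF V(1)] MV by (metis Diff_subset le_add_diff_inverse2 subset_trans)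
    ultimately show ?thesis
      using l by simp
  qed
  moreover have "M \<subseteq> V"
    using MV by blast
  ultimately show False
    using HL M(2) unfolding HL_indecomposable_def by (metis not_less_eq_eq numeral_2_eq_2 One_nat_def)
qed

section \<open>Normalisation by one row and choice of the signs\<close>

theorem theorem3:
  fixes V :: "'v set" and A B :: "'v \<Rightarrow> 'v \<Rightarrow> 'k::field"
  assumes "finite V" and "card V \<ge> 4"
    and "CHAR('k) \<noteq> 2"
    and "skew_symmetric_on V A" and "skew_symmetric_on V B"
    and "dense_on V A" and "HL_indecomposable V A"
    and "\<And>X. X \<subseteq> V \<Longrightarrow> X \<noteq> {} \<Longrightarrow> card X \<le> 4 \<Longrightarrow> det (submat A X X) = det (submat B X X)"
  shows "(\<exists>d :: 'v \<Rightarrow> 'k. (\<forall>i\<in>V. d i \<in> {-1, 1}) \<and>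
            (submat B V V = submat (diag_matrix d) V V * submat A V V * submat (diag_matrix d) V V \<or>
             transpose_mat (submat B V V) =
               submat (diag_matrix d) V V * submat A V V * submat (diag_matrix d) V V)) \<and>
         det (submat A V V) = det (submat B V V)"
proof -
  have two: "(2::'k) \<noteq> 0"
  proof
    assume "(2::'k) = 0"
    then have "of_nat 2 = (0::'k)"
      by simp
    then have "CHAR('k) dvd 2"
      by (simp only: of_nat_eq_0_iff_char_dvd)
    then have "CHAR('k) = 1 \<or> CHAR('k) = 2"
      using two_is_prime_nat unfolding prime_nat_iff by blast
    then show False
      using assms(3) CHAR_not_1' by auto
  qed
  have skA: "A j i = - A i j" and skB: "B j i = - B i j" if "i \<in> V" "j \<in> V" for i j
    using assms(4,5) that unfolding skew_symmetric_on_def by blast+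
  have diag0: "x = 0" if "x = - x" for x :: 'k
  proof -
    have "2 * x = 0"
      using that by (metis add.right_inverse mult_2)
    then show ?thesis using two by simp
  qed
  have dA: "A i i = 0" and dB: "B i i = 0" if "i \<in> V" for i
    by (rule diag0[OF skA[OF that that]], rule diag0[OF skB[OF that that]])
  have nzA: "A i j \<noteq> 0" if "i \<in> V" "j \<in> V" "i \<noteq> j" for i j
    using assms(6) that by (auto simp: dense_on_def)
  have sq2: "(A i j)\<^sup>2 = (B i j)\<^sup>2" if "i \<in> V" "j \<in> V" "i \<noteq> j" for i j
  proof -
    have "det (submat A {i, j} {i, j}) = det (submat B {i, j} {i, j})"
      using that by (intro assms(8)) auto
    then show ?thesis
      using det_submat_2[of i j A] det_submat_2[of i j B] dA dB skA[of i j] skB[of i j] that by simp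
  qed
  have sq4: "(pfaffian4 A i j k l)\<^sup>2 = (pfaffian4 B i j k l)\<^sup>2"
    if "i \<in> V" "j \<in> V" "k \<in> V" "l \<in> V" "distinct [i, j, k, l]" for i j k l
  proof -
    have sub: "{i, j, k, l} \<subseteq> V"
      using that by simp
    have "det (submat A {i, j, k, l} {i, j, k, l}) = det (submat B {i, j, k, l} {i, j, k, l})"
      using that by (intro assms(8)) auto
    moreover have "det (submat A {i, j, k, l} {i, j, k, l}) = (pfaffian4 A i j k l)\<^sup>2"
      by (rule det_submat_4[OF that(5)]) (assumption | rule dA skA subsetD[OF sub])+
    moreover have "det (submat B {i, j, k, l} {i, j, k, l}) = (pfaffian4 B i j k l)\<^sup>2"
      by (rule det_submat_4[OF that(5)]) (assumption | rule dB skB subsetD[OF sub])+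
    ultimately show ?thesis
      by simp
  qed
  obtain v where v: "v \<in> V"
    using assms(2) by fastforce
  define W where "W = V - {v}"
  \<comment> \<open>Diagonal scaling that turns the row of \<open>v\<close> into ones off the
    diagonal, so that only the entries on \<open>W\<close> remain to be compared.\<close>
  define w where "w i j = A i j / (A v i * A v j)" for i j
  define u where "u i j = B i j / (B v i * B v j)" for i j
  have W: "finite W" "card W \<ge> 3"
    using assms(1,2) v by (auto simp: W_def)
  have inV: "i \<in> V" "i \<noteq> v" if "i \<in> W" for i
    using that by (auto simp: W_def)
  have nzv: "A v i \<noteq> 0" "(A v i)\<^sup>2 = (B v i)\<^sup>2" "B v i \<noteq> 0" if "i \<in> W" for i
    using nzA[of v i] sq2[of v i] v inV[OF that] by auto
  have dich: "(\<forall>i\<in>W. \<forall>j\<in>W. i \<noteq> j \<longrightarrow> u i j = w i j) \<or> (\<forall>i\<in>W. \<forall>j\<in>W. i \<noteq> j \<longrightarrow> u i j = - w i j)"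
  proof (rule sign_dichotomy[OF W two])
    fix i j assume ij: "i \<in> W" "j \<in> W"
    show "w i j = - w j i" "u i j = - u j i"
      using skA[of j i] skB[of j i] inV ij by (simp_all add: w_def u_def mult.commute)
    assume "i \<noteq> j"
    then show "w i j \<noteq> 0" "(u i j)\<^sup>2 = (w i j)\<^sup>2"
      using nzA[of i j] sq2[of i j] inV nzv ij by (simp_all add: w_def u_def power_divide power_mult_distrib)
  next
    fix i j k assume h: "i \<in> W" "j \<in> W" "k \<in> W" "distinct [i, j, k]"
    \<comment> \<open>With the row of \<open>v\<close> scaled to ones, the Pfaffian on
      \<open>v\<close>, \<open>i\<close>, \<open>j\<close>, \<open>k\<close> becomes linear.\<close>
    have "w j k - w i k + w i j = pfaffian4 A v i j k / (A v i * A v j * A v k)"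
      using nzv h by (simp add: w_def pfaffian4_def field_simps)
    moreover have "u j k - u i k + u i j = pfaffian4 B v i j k / (B v i * B v j * B v k)"
      using nzv h by (simp add: u_def pfaffian4_def field_simps)
    moreover have "(pfaffian4 A v i j k)\<^sup>2 = (pfaffian4 B v i j k)\<^sup>2"
      using v h inV by (intro sq4) auto
    ultimately show "(u j k - u i k + u i j)\<^sup>2 = (w j k - w i k + w i j)\<^sup>2"
      using nzv h by (simp add: power_divide power_mult_distrib)
  next
    fix i j k l assume h: "i \<in> W" "j \<in> W" "k \<in> W" "l \<in> W" "distinct [i, j, k, l]"
    have "pfaffian4 w i j k l = pfaffian4 A i j k l / (A v i * A v j * A v k * A v l)"
      using nzv h by (simp add: w_def pfaffian4_def field_simps)
    moreover have "pfaffian4 u i j k l = pfaffian4 B i j k l / (B v i * B v j * B v k * B v l)"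
      using nzv h by (simp add: u_def pfaffian4_def field_simps)
    moreover have "(pfaffian4 A i j k l)\<^sup>2 = (pfaffian4 B i j k l)\<^sup>2"
      using h inV by (intro sq4) auto
    ultimately show "(pfaffian4 u i j k l)\<^sup>2 = (pfaffian4 w i j k l)\<^sup>2"
      using nzv h by (simp add: power_divide power_mult_distrib)
  next
    show "primitive W w"
      unfolding W_def w_def[abs_def]
      by (rule HL_indecomposable_imp_primitive[OF assms(1) v skA _ assms(7)]) (assumption | rule nzv | simp add: W_def)+
  qed
  then obtain c :: 'k where c: "c \<in> {1, -1}" "\<And>i j. i \<in> W \<Longrightarrow> j \<in> W \<Longrightarrow> i \<noteq> j \<Longrightarrow> u i j = c * w i j"
  proof
    assume "\<forall>i\<in>W. \<forall>j\<in>W. i \<noteq> j \<longrightarrow> u i j = w i j"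
    then show thesis by (intro that[of 1]) auto
  next
    assume "\<forall>i\<in>W. \<forall>j\<in>W. i \<noteq> j \<longrightarrow> u i j = - w i j"
    then show thesis by (intro that[of "-1"]) auto
  qed
  have cc: "c * c = 1"
    using c(1) by auto
  \<comment> \<open>The row of \<open>v\<close> dictates \<open>d\<close> on \<open>W\<close>;
    \<open>d v = c\<close> cancels the factor \<open>c\<close> of \<open>BA\<close> in that row, as
    \<open>c * c = 1\<close>.\<close>
  define d where "d i = (if i = v then c else B v i / A v i)" for i
  have d1: "d i \<in> {-1, 1}" if "i \<in> V" for i
  proof (cases "i = v")
    case True
    then show ?thesis using c(1) by (auto simp: d_def)
  next
    case False
    then have "i \<in> W" using that by (simp add: W_def)
    then have "(A v i)\<^sup>2 = (B v i)\<^sup>2" "A v i \<noteq> 0"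
      using nzv by auto
    then show ?thesis
      using False by (auto simp: d_def power2_eq_iff)
  qed
  have BA: "B i j = c * (d i * A i j * d j)" if ij: "i \<in> V" "j \<in> V" for i j
  proof -
    have vj: "B v j = c * (d v * A v j * d j)" if "j \<in> W" for j
      using nzv[OF that] inV[OF that] cc by (simp add: d_def mult.assoc[symmetric])
    consider "i = j" | "i = v" "j \<in> W" | "j = v" "i \<in> W" | "i \<noteq> j" "i \<in> W" "j \<in> W"
      using ij unfolding W_def by blast
    then show ?thesis
    proof cases
      case 1
      then show ?thesis using dA dB ij by simp
    next
      case 2
      then show ?thesis using vj by simp
    next
      case 3
      then have "B i j = - B v i" "A i j = - A v i"
        using skA[of v i] skB[of v i] v that by auto
      then show ?thesis
        using vj[OF 3(2)] 3(1) by (simp add: ac_simps)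
    next
      case 4
      have "B i j / (B v i * B v j) = c * (A i j / (A v i * A v j))"
        using c(2)[of i j] 4 by (simp add: u_def w_def)
      then show ?thesis
        using nzv 4 inV by (simp add: d_def field_simps)
    qed
  qed
  let ?DAD = "submat (diag_matrix d) V V * submat A V V * submat (diag_matrix d) V V"
  have DAD: "?DAD = submat (\<lambda>i j. d i * A i j * d j) V V"
    by (rule diag_submat_mult[OF assms(1)])
  have mem: "from_nat_into V i \<in> V" if "i < card V" for i
    using that by (metis card.empty from_nat_into less_nat_zero_code)
  have alt: "submat B V V = ?DAD \<or> transpose_mat (submat B V V) = ?DAD"
  proof (cases "c = 1")
    case True
    then have "submat B V V = ?DAD"
      unfolding DAD using BA mem by (intro eq_matI) (auto simp: submat_def)
    then show ?thesis ..
  next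
    case False
    \<comment> \<open>Here \<open>c = -1\<close>, and skew-symmetry of \<open>B\<close> turns the
      sign into a transpose.\<close>
    then have "B j i = d i * A i j * d j" if "i \<in> V" "j \<in> V" for i j
      using BA[OF that] skB[OF that] c(1) by auto
    then have "transpose_mat (submat B V V) = ?DAD"
      unfolding DAD using mem by (intro eq_matI) (auto simp: submat_def)
    then show ?thesis ..
  qed
  have "det ?DAD = det (submat A V V)"
    using assms(1) d1 by (rule det_diag_conjugate)
  moreover have "det (transpose_mat (submat B V V)) = det (submat B V V)"
    by (rule det_transpose[of _ "card V"]) (simp add: submat_def)
  ultimately have "det (submat A V V) = det (submat B V V)"
    using alt by metis
  with alt d1 show ?thesis
    by blast
qed

end
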